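(* \[ \sum_{k=1}^{\infty}(8k-1)\frac{(1)_k(-\tfrac{1}{4})_k(-\tfrac{3}{4})_k}{(\tfrac{1}{2})_k^2(\tfrac{3}{2})_k\,9^k}\sum_{i=1}^{k}\left\{\frac{1}{(2i-1)^2}-\frac{9}{4i^2}\right\}=-\frac{\sqrt{3}\,\pi^3}{108}. \]
   Context: For a complex number $x$ and a nonnegative integer $n$, $(x)_n=\Gamma(x+n)/\Gamma(x)=x(x+1)\cdots(x+n-1)$ denotes the shifted factorial (Pochhammer symbol), with $(x)_0=1$. *)

theory Defs
  imports "HOL-Analysis.Analysis"
begin

end

theory Submission
  imports Defs "HOL-Real_Asymp.Real_Asymp"
begin

text \<open>
  Replacing the factor \<open>(1)\<^sub>k\<^sup>2 / (1/2)\<^sub>k\<^sup>2\<close> by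
  \<open>(1 + 3x)\<^sub>k (1 - 3x)\<^sub>k / ((1/2 + x)\<^sub>k (1/2 - x)\<^sub>k)\<close> turns the inner sum into (a quarter of)
  the coefficient of \<open>x\<^sup>2\<close>, and the deformed series equals \<open>- tan (\<pi> x) / (3 \<surd>3 x)\<close>.
  To evaluate it, embed it at \<open>A = -1/2\<close> in a family of series \<open>S(A)\<close> of Gasper's cubic type. A WZ
  certificate relates \<open>S(A)\<close> to \<open>S(A + 3)\<close> by a rational factor; the product of these factors is a
  quotient of Gamma values, and as \<open>A \<rightarrow> \<infinity>\<close> the terms of \<open>S(A) / A\<close> tend to those of the
  series \<open>F(1 + y, 1 - y; 3/2; sin\<^sup>2 z)\<close> with \<open>y = 3x\<close>, \<open>z = \<pi>/6\<close>, which sums to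
  \<open>sin (2yz) / (y sin 2z)\<close>. The limits are exchanged with the sums by Tannery's theorem.
\<close>

section \<open>Deformed hypergeometric terms and their geometric bound\<close>

text \<open>Factors of index \<open>2*k\<close> are duplicated pairs: (2)_{2k} = 4^k (1)_k (3/2)_k,
  and at \<open>A = -1/2\<close> also (A-1)_{2k} = 4^k (-3/4)_k (-1/4)_k. There (A+2)/3 = 1/2, so
  \<open>x = 0\<close> gives exactly the \<open>pochhammer\<close> quotient of the theorem.\<close>

definition hyp_term :: "real \<Rightarrow> real \<Rightarrow> nat \<Rightarrow> real" where
  "hyp_term A x k = pochhammer (1 + 3*x) k * pochhammer (1 - 3*x) k * pochhammer (A - 1) (2*k) /
     (pochhammer 2 (2*k) * pochhammer ((A+2)/3 - x) k * pochhammer ((A+2)/3 + x) k * 9^k)"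

lemma hyp_term_0 [simp]: "hyp_term A x 0 = 1"
  by (simp add: hyp_term_def)

lemma pochhammer_double_Suc:
  "pochhammer a (2 * Suc k) = pochhammer a (2*k) * (a + 2 * of_nat k) * (a + 2 * of_nat k + 1)"
  for a :: "'a::comm_ring_1"
  by (simp add: pochhammer_Suc algebra_simps)

text \<open>The ratio is split into a factor free of \<open>A\<close> and one that tends to 1 as
  \<open>A\<close> grows. The geometric bound and the limit in \<open>A\<close> treat the two
  separately.\<close>

lemma hyp_term_Suc:
  "hyp_term A x (Suc k) = hyp_term A x k *
     ((real k + 1)\<^sup>2 - (3*x)\<^sup>2) / ((2 * real k + 2) * (2 * real k + 3)) *
     ((A - 1 + 2 * real k) * (A + 2 * real k) / ((A + 2 + 3 * real k)\<^sup>2 - (3*x)\<^sup>2))"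
proof -
  have 1: "(A + 2 + 3 * real k)\<^sup>2 - (3*x)\<^sup>2 = (((A+2)/3 - x + real k) * ((A+2)/3 + x + real k)) * 9"
    by (simp add: power2_eq_square field_simps)
  have 2: "(real k + 1)\<^sup>2 - (3*x)\<^sup>2 = (1 + 3*x + real k) * (1 - 3*x + real k)"
    by (simp add: power2_eq_square algebra_simps)
  show ?thesis
    unfolding 1 2 hyp_term_def pochhammer_double_Suc pochhammer_Suc[of _ k]
    by (simp add: mult_ac add_ac)
qed

text \<open>The part of the term ratio without \<open>A\<close> is at most 1/4, because (k+1)^2 is
  at most (k+1)(k+3/2). The other part is at most 1: with \<open>M = A + 2 + 3 * real k\<close>, the
  condition \<open>A \<ge> -1/2\<close> gives |A - 1 + 2k| \<le> M and |A + 2k| \<le> M - 1. The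
  bound is uniform in \<open>A\<close> and \<open>x\<close>, as dominated limits in either parameter
  require.\<close>

lemma abs_hyp_term_le:
  assumes "A \<ge> -1/2" "\<bar>x\<bar> \<le> 1/4"
  shows "\<bar>hyp_term A x k\<bar> \<le> (1/4)^k"
proof (induction k)
  case (Suc k)
  define M where "M = A + 2 + 3 * real k"
  have x2: "(3*x)\<^sup>2 \<le> 9/16"
    using assms(2) abs_le_square_iff[of x "1/4"] by (simp add: power2_eq_square)
  have M: "M \<ge> 3/2" using assms by (simp add: M_def)
  have M2: "M * (M - 1) \<le> M\<^sup>2 - (3*x)\<^sup>2"
    using x2 M by (simp add: power2_eq_square algebra_simps)
  have M3: "M * (M - 1) > 0" using M by simp
  have "\<bar>(A - 1 + 2 * real k) * (A + 2 * real k)\<bar> \<le> M * (M - 1)"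
    unfolding abs_mult using assms(1) by (intro mult_mono) (auto simp: M_def)
  with M2 M3 have 1: "\<bar>(A - 1 + 2 * real k) * (A + 2 * real k) / (M\<^sup>2 - (3*x)\<^sup>2)\<bar> \<le> 1"
    by (simp add: abs_divide)
  have "(3*x)\<^sup>2 \<le> (real k + 1)\<^sup>2"
    using x2 one_le_power[of "real k + 1" 2] by linarith
  then have 2: "\<bar>((real k + 1)\<^sup>2 - (3*x)\<^sup>2) / ((2 * real k + 2) * (2 * real k + 3))\<bar> \<le> 1/4"
    by (simp add: abs_divide divide_simps) (simp add: power2_eq_square algebra_simps)
  have "\<bar>hyp_term A x (Suc k)\<bar> = \<bar>hyp_term A x k\<bar> *
      \<bar>((real k + 1)\<^sup>2 - (3*x)\<^sup>2) / ((2 * real k + 2) * (2 * real k + 3))\<bar> *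
      \<bar>(A - 1 + 2 * real k) * (A + 2 * real k) / (M\<^sup>2 - (3*x)\<^sup>2)\<bar>"
    unfolding hyp_term_Suc M_def abs_mult[symmetric] by simp
  also have "\<dots> \<le> (1/4)^k * (1/4) * 1"
    using 1 2 Suc.IH by (intro mult_mono) auto
  finally show ?case by simp
qed simp

lemma summable_linear_geometric:
  "summable (\<lambda>k. (a + b * real k) * (1/4::real)^k)"
proof -
  have "summable (\<lambda>k. a * (1/4::real)^k + b * (real k * (1/4)^k))"
    by (intro summable_add summable_mult summable_geometric)
       (auto intro!: summable_ratio_test[of "1/2" 1])
  then show ?thesis by (simp add: algebra_simps)
qed

lemma summable_hyp_term:
  assumes "A \<ge> -1/2" "\<bar>x\<bar> \<le> 1/4"
  shows "summable (\<lambda>k. (A + 4 * real k) * hyp_term A x k)"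
proof (rule summable_comparison_test[OF exI, OF allI, OF impI])
  show "norm ((A + 4 * real k) * hyp_term A x k) \<le> (\<bar>A\<bar> + 4 * real k) * (1/4)^k" for k
    unfolding norm_mult using abs_hyp_term_le[OF assms] by (intro mult_mono) auto
  show "summable (\<lambda>k. (\<bar>A\<bar> + 4 * real k) * (1/4)^k)"
    by (rule summable_linear_geometric)
qed

section \<open>The recurrence from \<open>A\<close> to \<open>A + 3\<close>\<close>

text \<open>Raising \<open>A\<close> by 3 moves (A+2)/3 by exactly 1 and A - 1 by 3, so all
  Pochhammer quotients collapse to finitely many linear factors. They are cross-multiplied here,
  which avoids dividing by \<open>A\<close>, \<open>A + 1\<close> and \<open>A - 1\<close>.\<close>

lemma hyp_term_shift:
  assumes "\<And>k. (A + 2 + 3 * real k)\<^sup>2 \<noteq> (3*x)\<^sup>2"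
  shows "A * (A+1) * (A-1) * hyp_term (A+3) x k * ((A + 2 + 3 * real k)\<^sup>2 - (3*x)\<^sup>2) =
    hyp_term A x k * (A - 1 + 2 * real k) * (A + 2 * real k) * (A + 1 + 2 * real k) *
      ((A + 2)\<^sup>2 - (3*x)\<^sup>2)"
proof (induction k)
  case 0
  show ?case by simp
next
  case (Suc k)
  define D where "D n = (A + 2 + 3 * real n)\<^sup>2 - (3*x)\<^sup>2" for n
  have D: "D n \<noteq> 0" for n using assms[of n] by (simp add: D_def)
  have D': "(A + 3 + 2 + 3 * real k)\<^sup>2 - (3*x)\<^sup>2 = D (Suc k)"
    by (simp add: D_def algebra_simps)
  define C where "C = ((real k + 1)\<^sup>2 - (3*x)\<^sup>2) / ((2 * real k + 2) * (2 * real k + 3))"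
  have IH: "A * (A+1) * (A-1) * hyp_term (A+3) x k =
     hyp_term A x k * (A - 1 + 2 * real k) * (A + 2 * real k) * (A + 1 + 2 * real k) * D 0 / D k"
    using Suc.IH D[of k] by (simp add: D_def field_simps)
  have "A * (A+1) * (A-1) * hyp_term (A+3) x (Suc k) * D (Suc k) =
     A * (A+1) * (A-1) * hyp_term (A+3) x k * C * ((A + 2 + 2 * real k) * (A + 3 + 2 * real k))"
    unfolding hyp_term_Suc D' C_def[symmetric] times_divide_eq_right[symmetric]
    using D[of "Suc k"] by (simp add: field_simps)
  also have "\<dots> = hyp_term A x (Suc k) * (A + 1 + 2 * real k) * D 0 * ((A + 2 + 2 * real k) * (A + 3 + 2 * real k))"
    unfolding IH hyp_term_Suc D_def[symmetric] C_def[symmetric] times_divide_eq_right[symmetric] by simp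
  finally show ?case
    by (simp add: D_def algebra_simps)
qed

text \<open>
  The certificate was found by Gosper's method: after clearing denominators, the unknown polynomial
  in \<open>k\<close> is a constant.
\<close>
lemma telescoping_hyp_term:
  assumes "A \<noteq> 0" "A \<noteq> 1" "A \<noteq> -1" "\<And>k. (A + 2 + 3 * real k)\<^sup>2 \<noteq> (3*x)\<^sup>2"
  shows "A * (A+1) / ((A + 2)\<^sup>2 - (3*x)\<^sup>2) * (\<Sum>k<n. (A + 3 + 4 * real k) * hyp_term (A+3) x k)
     - (\<Sum>k<n. (A + 4 * real k) * hyp_term A x k) = - (2 * real n * (2 * real n + 1) / (A - 1) * hyp_term A x n)"
proof (induction n)
  case (Suc k)
  define D where "D n = (A + 2 + 3 * real n)\<^sup>2 - (3*x)\<^sup>2" for n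
  have D: "D n \<noteq> 0" for n using assms(4)[of n] by (simp add: D_def)
  have D0: "(A + 2)\<^sup>2 - (3*x)\<^sup>2 = D 0" by (simp add: D_def)
  define W where "W = hyp_term A x k"
  have A1: "A - 1 \<noteq> 0" using assms by simp
  have 1: "A * (A+1) / D 0 * hyp_term (A+3) x k =
      W * (A - 1 + 2 * real k) * (A + 2 * real k) * (A + 1 + 2 * real k) / (D k * (A - 1))"
    using hyp_term_shift[OF assms(4), of k, folded D_def, unfolded D0, folded W_def] D[of 0] D[of k] A1
    by (simp add: divide_simps) (simp add: mult_ac)
  have 2: "2 * real (Suc k) * (2 * real (Suc k) + 1) * hyp_term A x (Suc k) =
      W * ((real k + 1)\<^sup>2 - (3*x)\<^sup>2) * ((A - 1 + 2 * real k) * (A + 2 * real k)) / D k"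
  proof -
    have "2 * real (Suc k) * (2 * real (Suc k) + 1) = (2 * real k + 2) * (2 * real k + 3)"
      by (simp add: algebra_simps)
    moreover have "2 * real k + 2 \<noteq> 0" "2 * real k + 3 \<noteq> 0"
      by linarith+
    ultimately show ?thesis
      unfolding hyp_term_Suc W_def[symmetric] D_def[symmetric] by simp
  qed
  \<comment> \<open>Once \<open>W / (D k * (A - 1))\<close> is taken out, the telescoping equation
    is this polynomial identity in \<open>A\<close>, \<open>x\<close> and \<open>k\<close>.\<close>
  have key: "(A - 1 + 2 * real k) * (A + 2 * real k) * (A + 1 + 2 * real k) * (A + 3 + 4 * real k)
      - (A + 4 * real k) * (A - 1) * D k =
      2 * real k * (2 * real k + 1) * D k
      - ((real k + 1)\<^sup>2 - (3*x)\<^sup>2) * ((A - 1 + 2 * real k) * (A + 2 * real k))"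
    unfolding D_def by algebra
  have "A * (A+1) / D 0 * ((A + 3 + 4 * real k) * hyp_term (A+3) x k) - (A + 4 * real k) * W =
     W * ((A - 1 + 2 * real k) * (A + 2 * real k) * (A + 1 + 2 * real k) * (A + 3 + 4 * real k)
      - (A + 4 * real k) * (A - 1) * D k) / (D k * (A - 1))"
  proof -
    have 3: "A * (A+1) / D 0 * ((A + 3 + 4 * real k) * hyp_term (A+3) x k) =
        (A + 3 + 4 * real k) * (A * (A+1) / D 0 * hyp_term (A+3) x k)"
      by (simp only: mult_ac)
    show ?thesis
      unfolding 3 1 using D[of k] A1 by (simp add: divide_simps) (simp add: algebra_simps)
  qed
  also have "\<dots> = 2 * real k * (2 * real k + 1) / (A - 1) * W
      - (2 * real (Suc k) * (2 * real (Suc k) + 1) * hyp_term A x (Suc k)) / (A - 1)"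
  proof -
    have "W * (e * D k - g * h) / (D k * (A - 1)) = e / (A - 1) * W - W * g * h / D k / (A - 1)" for e g h
      using D[of k] A1 by (simp add: divide_simps) (simp add: algebra_simps)
    then show ?thesis unfolding key 2 .
  qed
  finally have step: "A * (A+1) / D 0 * ((A + 3 + 4 * real k) * hyp_term (A+3) x k) - (A + 4 * real k) * W =
      2 * real k * (2 * real k + 1) / (A - 1) * W
      - 2 * real (Suc k) * (2 * real (Suc k) + 1) / (A - 1) * hyp_term A x (Suc k)"
    by (simp only: times_divide_eq_left)
  have "r * (X + e) - (Y + g) = - q" if "r * X - Y = - p" "r * e - g = p - q" for r X Y e g p q :: real
    using that by (simp add: algebra_simps)
  from this[OF Suc.IH step[folded D0, unfolded W_def]] show ?case
    unfolding sum.lessThan_Suc .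
qed simp

definition hyp_sum :: "real \<Rightarrow> real \<Rightarrow> real" where
  "hyp_sum A x = (\<Sum>k. (A + 4 * real k) * hyp_term A x k)"

text \<open>In the limit of the telescoped sums the boundary term vanishes, being of order n^2 /
  4^n.\<close>

lemma hyp_sum_shift:
  assumes "A \<ge> -1/2" "\<bar>x\<bar> \<le> 1/4" "A \<noteq> 0" "A \<noteq> 1"
  shows "hyp_sum A x = A * (A+1) / ((A + 2)\<^sup>2 - (3*x)\<^sup>2) * hyp_sum (A+3) x"
proof -
  \<comment> \<open>The base on the left is at least 3/2, while |3x| is at most 3/4.\<close>
  have ne: "(A + 2 + 3 * real k)\<^sup>2 \<noteq> (3*x)\<^sup>2" for k
    using assms unfolding power2_eq_iff by auto
  have 1: "(\<lambda>n. A * (A+1) / ((A + 2)\<^sup>2 - (3*x)\<^sup>2) * (\<Sum>k<n. (A + 3 + 4 * real k) * hyp_term (A+3) x k)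
     - (\<Sum>k<n. (A + 4 * real k) * hyp_term A x k))
     \<longlonglongrightarrow> A * (A+1) / ((A + 2)\<^sup>2 - (3*x)\<^sup>2) * hyp_sum (A+3) x - hyp_sum A x"
    unfolding hyp_sum_def using assms by (intro tendsto_intros summable_LIMSEQ summable_hyp_term) auto
  have "(\<lambda>n. 2 * real n * (2 * real n + 1) / (A - 1) * hyp_term A x n) \<longlonglongrightarrow> 0"
  proof (rule Lim_null_comparison[OF always_eventually[OF allI]])
    show "norm (2 * real n * (2 * real n + 1) / (A - 1) * hyp_term A x n)
       \<le> \<bar>1 / (A - 1)\<bar> * (2 * real n * (2 * real n + 1) * (1/4)^n)" for n
      using mult_left_mono[OF abs_hyp_term_le[OF assms(1,2), of n], of "2 * real n * (2 * real n + 1) / \<bar>A - 1\<bar>"]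
      by (simp add: abs_mult)
    have "(\<lambda>n. 2 * real n * (2 * real n + 1) * (1/4)^n) \<longlonglongrightarrow> 0"
      by real_asymp
    then show "(\<lambda>n. \<bar>1 / (A - 1)\<bar> * (2 * real n * (2 * real n + 1) * (1/4)^n)) \<longlonglongrightarrow> 0"
      by (rule tendsto_mult_right_zero)
  qed
  from tendsto_minus[OF this] have 2: "(\<lambda>n. - (2 * real n * (2 * real n + 1) / (A - 1) * hyp_term A x n)) \<longlonglongrightarrow> 0"
    by simp
  have "A \<noteq> -1" using assms(1) by auto
  from LIMSEQ_unique[OF 1[unfolded telescoping_hyp_term[OF assms(3,4) this ne]] 2]
  show ?thesis by simp
qed

section \<open>The series F(1 + y, 1 - y; 3/2; sin^2 z) in closed form\<close>

text \<open>
  The recurrence says that the power series \<open>h\<close> solves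
  \<open>(1 - s\<^sup>2) h'' - 3 s h' - (1 - c\<^sup>2) h = 0\<close>, so \<open>u z = cos z * h (sin z)\<close> solves \<open>u'' = - c\<^sup>2 u\<close>.
\<close>
lemma sin_multiple_powser:
  fixes a :: "nat \<Rightarrow> real"
  assumes a0: "a 0 = 0" and a1: "a 1 = 1"
    and rec: "\<And>n. (real n + 2) * (real n + 1) * a (n + 2) = ((real n + 1)\<^sup>2 - c\<^sup>2) * a n"
    and conv: "\<And>s. \<bar>s\<bar> < 1 \<Longrightarrow> summable (\<lambda>n. a n * s ^ n)"
    and z: "z \<in> {-(pi/2)<..<pi/2}"
  shows "c * (cos z * (\<Sum>n. a n * sin z ^ n)) = sin (c * z)"
proof -
  define h where "h = (\<lambda>s. \<Sum>n. a n * s ^ n)"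
  define h1 where "h1 = (\<lambda>s. \<Sum>n. diffs a n * s ^ n)"
  define h2 where "h2 = (\<lambda>s. \<Sum>n. diffs (diffs a) n * s ^ n)"
  have conv1: "summable (\<lambda>n. diffs a n * s ^ n)" if "\<bar>s\<bar> < 1" for s
    by (rule termdiff_converges[of s 1]) (use that conv in auto)
  have conv2: "summable (\<lambda>n. diffs (diffs a) n * s ^ n)" if "\<bar>s\<bar> < 1" for s
    by (rule termdiff_converges[of s 1]) (use that conv1 in auto)
  have dh: "(h has_field_derivative h1 s) (at s)" if "\<bar>s\<bar> < 1" for s
    unfolding h_def h1_def by (rule termdiffs_strong'[of 1]) (use that conv in auto)
  have dh1: "(h1 has_field_derivative h2 s) (at s)" if "\<bar>s\<bar> < 1" for s
    unfolding h1_def h2_def by (rule termdiffs_strong'[of 1]) (use that conv1 in auto)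
  \<comment> \<open>On the coefficients of s^n this is \<open>rec\<close>, since n(n-1) + 3n + 1 =
    (n+1)^2.\<close>
  have ode: "(1 - s\<^sup>2) * h2 s - 3 * s * h1 s - h s = - (c\<^sup>2 * h s)" if s: "\<bar>s\<bar> < 1" for s
  proof -
    have H: "(\<lambda>n. a n * s ^ n) sums h s"
      unfolding h_def by (rule summable_sums[OF conv[OF s]])
    have "(\<lambda>n. s * (real n * a n * s ^ (n - Suc 0))) sums (s * h1 s)"
      unfolding h1_def by (intro sums_mult diffs_equiv[OF conv1[OF s], simplified])
    also have "(\<lambda>n. s * (real n * a n * s ^ (n - Suc 0))) = (\<lambda>n. real n * a n * s ^ n)"
    proof
      show "s * (real n * a n * s ^ (n - Suc 0)) = real n * a n * s ^ n" for n
        by (cases n) auto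
    qed
    finally have H1: "(\<lambda>n. real n * a n * s ^ n) sums (s * h1 s)" .
    have "(\<lambda>n. s\<^sup>2 * (real n * diffs a n * s ^ (n - Suc 0))) sums (s\<^sup>2 * h2 s)"
      unfolding h2_def by (intro sums_mult diffs_equiv[OF conv2[OF s], simplified])
    also have "(\<lambda>n. s\<^sup>2 * (real n * diffs a n * s ^ (n - Suc 0))) =
        (\<lambda>n. real (Suc n) * (real (Suc n) - 1) * a (Suc n) * s ^ Suc n)"
    proof
      show "s\<^sup>2 * (real n * diffs a n * s ^ (n - Suc 0)) =
          real (Suc n) * (real (Suc n) - 1) * a (Suc n) * s ^ Suc n" for n
        by (cases n) (auto simp: diffs_def power2_eq_square)
    qed
    finally have "(\<lambda>n. real (Suc n) * (real (Suc n) - 1) * a (Suc n) * s ^ Suc n) sums (s\<^sup>2 * h2 s)" .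
    \<comment> \<open>The term of index 0 that is put back vanishes through its factor
      \<open>real n\<close>.\<close>
    from sums_Suc[OF this]
    have H2: "(\<lambda>n. real n * (real n - 1) * a n * s ^ n) sums (s\<^sup>2 * h2 s)"
      by simp
    have "(\<lambda>n. real n * (real n - 1) * a n * s ^ n + 3 * (real n * a n * s ^ n) + a n * s ^ n
        - c\<^sup>2 * (a n * s ^ n)) sums (s\<^sup>2 * h2 s + 3 * (s * h1 s) + h s - c\<^sup>2 * h s)"
      by (intro sums_add sums_diff sums_mult H H1 H2)
    also have "(\<lambda>n. real n * (real n - 1) * a n * s ^ n + 3 * (real n * a n * s ^ n) + a n * s ^ n
        - c\<^sup>2 * (a n * s ^ n)) = (\<lambda>n. ((real n + 1)\<^sup>2 - c\<^sup>2) * a n * s ^ n)"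
      by (intro ext) (simp add: algebra_simps power2_eq_square)
    also have "\<dots> = (\<lambda>n. diffs (diffs a) n * s ^ n)"
      unfolding rec[symmetric] by (intro ext) (simp add: diffs_def algebra_simps)
    finally have "h2 s = s\<^sup>2 * h2 s + 3 * (s * h1 s) + h s - c\<^sup>2 * h s"
      unfolding h2_def by (simp add: sums_iff)
    then show ?thesis by (simp add: algebra_simps)
  qed
  define u where "u = (\<lambda>t. cos t * h (sin t))"
  define v where "v = (\<lambda>t. (cos t)\<^sup>2 * h1 (sin t) - sin t * h (sin t))"
  have sin_less: "\<bar>sin t\<bar> < 1" if "t \<in> {-(pi/2)<..<pi/2}" for t
  proof -
    have "cos t > 0" using that by (intro cos_gt_zero_pi) auto
    then have "(sin t)\<^sup>2 < 1" by (simp add: sin_squared_eq)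
    then show ?thesis by (simp add: abs_square_less_1)
  qed
  have du: "(u has_field_derivative v t) (at t)" if "t \<in> {-(pi/2)<..<pi/2}" for t
    unfolding u_def v_def
    by (auto intro!: derivative_eq_intros DERIV_chain2[OF dh] sin_less[OF that] simp: power2_eq_square algebra_simps)
  have dv: "(v has_field_derivative - (c\<^sup>2 * u t)) (at t)" if "t \<in> {-(pi/2)<..<pi/2}" for t
  proof -
    have "(v has_field_derivative (cos t * ((cos t)\<^sup>2 * h2 (sin t) - 3 * sin t * h1 (sin t) - h (sin t)))) (at t)"
      unfolding v_def
      by (auto intro!: derivative_eq_intros DERIV_chain2[OF dh] DERIV_chain2[OF dh1] sin_less[OF that]
          simp: power2_eq_square algebra_simps)
    then show ?thesis
      unfolding cos_squared_eq ode[OF sin_less[OF that]] u_def by (simp add: mult_ac)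
  qed
  have h0: "h 0 = 0" "h1 0 = 1"
    using a0 a1 by (simp_all add: h_def h1_def diffs_def)
  have 0: "0 \<in> {-(pi/2)<..<pi/2}" by simp
  \<comment> \<open>With \<open>v = u'\<close>, the expressions in \<open>p\<close> and
    \<open>q\<close> are first integrals of u'' = -c^2 u. Their values at 0 are 1 and 0; recombining
    them with the sine and cosine of \<open>c*z\<close> isolates \<open>c * u z\<close>.\<close>
  have p: "v z * cos (c*z) + c * u z * sin (c*z) = v 0 * cos (c*0) + c * u 0 * sin (c*0)"
    by (rule DERIV_isconst3[OF _ z 0])
       (auto intro!: derivative_eq_intros du dv simp: power2_eq_square algebra_simps)
  have q: "v z * sin (c*z) - c * u z * cos (c*z) = v 0 * sin (c*0) - c * u 0 * cos (c*0)"
    by (rule DERIV_isconst3[OF _ z 0])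
       (auto intro!: derivative_eq_intros du dv simp: power2_eq_square algebra_simps)
  have "c * u z = c * u z * ((sin (c*z))\<^sup>2 + (cos (c*z))\<^sup>2)" by simp
  also have "\<dots> = (v z * cos (c*z) + c * u z * sin (c*z)) * sin (c*z)
      - (v z * sin (c*z) - c * u z * cos (c*z)) * cos (c*z)"
    by (simp only: algebra_simps power2_eq_square)
  also have "\<dots> = sin (c*z)"
    unfolding p q by (simp add: u_def v_def h0)
  finally show ?thesis
    by (simp add: u_def h_def)
qed

text \<open>As (2)_{2k} = 4^k k! (3/2)_k, the left side is sin z F(1+y, 1-y; 3/2; sin^2 z). Padded
  with zeros at even exponents, its coefficients satisfy the recurrence of
  \<open>sin_multiple_powser\<close> with \<open>c = 2*y\<close>; |y| \<le> 1 keeps them bounded by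
  1, which gives convergence on |s| < 1.\<close>

lemma sin_multiple_hypergeometric:
  fixes y z :: real
  assumes y: "\<bar>y\<bar> \<le> 1" "y \<noteq> 0" and z: "z \<in> {-(pi/2)<..<pi/2}"
  shows "(\<lambda>k. pochhammer (1 + y) k * pochhammer (1 - y) k * 4^k / pochhammer 2 (2*k) * sin z ^ (2*k+1))
     sums (sin (2*y*z) / (2*y * cos z))"
proof -
  define d where "d k = pochhammer (1 + y) k * pochhammer (1 - y) k * 4^k / pochhammer 2 (2*k)" for k
  define a where "a n = (if even n then 0 else d (n div 2))" for n
  have dSuc: "(2 * real k + 2) * (2 * real k + 3) * d (Suc k) = 4 * ((real k + 1)\<^sup>2 - y\<^sup>2) * d k" for k
  proof -
    define P :: real where "P = pochhammer 2 (2*k)"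
    have P: "P > 0" unfolding P_def by (intro pochhammer_pos) simp
    show ?thesis
      unfolding d_def pochhammer_double_Suc P_def[symmetric] pochhammer_Suc[of _ k] using P
      by (simp add: divide_simps) (simp add: power2_eq_square algebra_simps)
  qed
  have d_le: "\<bar>d k\<bar> \<le> 1" for k
  proof (induction k)
    case (Suc k)
    have "y\<^sup>2 \<le> 1" using y by (simp add: abs_square_le_1)
    moreover have "1 \<le> (real k + 1)\<^sup>2" by simp
    ultimately have 1: "\<bar>(real k + 1)\<^sup>2 - y\<^sup>2\<bar> \<le> (real k + 1)\<^sup>2"
      using zero_le_power2[of y] by linarith
    have "(2 * real k + 2) * (2 * real k + 3) * \<bar>d (Suc k)\<bar> = 4 * \<bar>(real k + 1)\<^sup>2 - y\<^sup>2\<bar> * \<bar>d k\<bar>"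
      using arg_cong[OF dSuc[of k], of abs] unfolding abs_mult by simp
    also have "\<dots> \<le> 4 * (real k + 1)\<^sup>2 * 1"
      using 1 Suc.IH by (intro mult_mono) auto
    also have "\<dots> \<le> (2 * real k + 2) * (2 * real k + 3) * 1"
      by (simp add: power2_eq_square algebra_simps)
    finally show ?case by (subst (asm) mult_le_cancel_left_pos) auto
  qed (simp add: d_def)
  have rec: "(real n + 2) * (real n + 1) * a (n + 2) = ((real n + 1)\<^sup>2 - (2*y)\<^sup>2) * a n" for n
  proof (cases "even n")
    case False
    then obtain k where "n = 2*k + 1" by (auto elim: oddE)
    then show ?thesis
      using dSuc[of k] by (simp add: a_def power2_eq_square algebra_simps)
  qed (simp add: a_def)
  have conv: "summable (\<lambda>n. a n * s ^ n)" if "\<bar>s\<bar> < 1" for s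
  proof (rule summable_comparison_test[OF exI, OF allI, OF impI])
    show "norm (a n * s ^ n) \<le> \<bar>s\<bar> ^ n" for n
      using mult_right_mono[OF d_le[of "n div 2"], of "\<bar>s\<bar>^n"] by (auto simp: a_def abs_mult power_abs)
  qed (use that in simp)
  have cz: "cos z > 0" using z by (intro cos_gt_zero_pi) auto
  then have "\<bar>sin z\<bar> < 1"
    using sin_squared_eq[of z] by (simp add: abs_square_less_1[symmetric])
  from summable_sums[OF conv[OF this]]
  have "(\<lambda>n. a n * sin z ^ n) sums (\<Sum>n. a n * sin z ^ n)" .
  also have "(\<Sum>n. a n * sin z ^ n) = sin (2*y*z) / (2*y * cos z)"
    using sin_multiple_powser[of a "2*y" z, OF _ _ rec conv z] y cz
    by (simp add: a_def d_def field_simps)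
  finally have *: "(\<lambda>n. a n * sin z ^ n) sums (sin (2*y*z) / (2*y * cos z))" .
  have "(\<lambda>k. a (2*k+1) * sin z ^ (2*k+1)) sums (sin (2*y*z) / (2*y * cos z))"
  proof (subst sums_mono_reindex[of "\<lambda>k. 2*k+1" "\<lambda>n. a n * sin z ^ n"])
    show "strict_mono (\<lambda>k::nat. 2*k+1)" by (rule strict_monoI) simp
    show "a n * sin z ^ n = 0" if "n \<notin> range (\<lambda>k. 2*k+1)" for n
      using that by (auto simp: a_def elim!: oddE)
  qed (rule *)
  then show ?thesis by (simp add: a_def d_def)
qed

section \<open>Asymptotics of the accumulated recurrence factors\<close>

lemma rGamma_reflection_real:
  "rGamma x * rGamma (1 - x) = sin (pi * x) / pi" for x :: real
proof -
  have "complex_of_real (rGamma x * rGamma (1 - x)) = complex_of_real (sin (pi * x) / pi)"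
    using rGamma_reflection_complex[of "of_real x"]
    by (simp add: rGamma_complex_of_real[symmetric] sin_of_real[symmetric])
  then show ?thesis by (simp only: of_real_eq_iff)
qed

text \<open>Each \<open>pochhammer z (Suc n)\<close> is \<open>rGamma_series z n\<close> up to n!
  and n^z, so the limit is a quotient of reciprocal Gamma values, which the reflection formula
  evaluates.\<close>

lemma pochhammer_ratio_LIMSEQ:
  fixes x :: real
  assumes x: "\<bar>x\<bar> < 1/2"
  shows "(\<lambda>n. real n * (pochhammer (-1/6) (Suc n) * pochhammer (1/6) (Suc n) /
      (pochhammer (1/2 - x) (Suc n) * pochhammer (1/2 + x) (Suc n)))) \<longlonglongrightarrow> - 1 / (12 * cos (pi * x))"
proof -
  have c: "cos (pi * x) > 0"
  proof (rule cos_gt_zero_pi)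
    have "pi * \<bar>x\<bar> < pi * (1/2)" using x by (intro mult_strict_left_mono) auto
    then have "\<bar>pi * x\<bar> < pi/2" by (simp add: abs_mult)
    then show "- (pi/2) < pi * x" "pi * x < pi/2" by linarith+
  qed
  have 1: "rGamma (1/2 - x) * rGamma (1/2 + x) = cos (pi * x) / pi"
    using rGamma_reflection_real[of "1/2 + x"]
    by (simp add: sin_add distrib_left mult.commute)
  \<comment> \<open>Shifting the argument to 5/6 makes the pair 1/6, 5/6 accessible to
    reflection.\<close>
  have "rGamma (-1/6) = - rGamma (5/6 :: real) / 6"
    using rGamma_plus1[of "-1/6::real"] by simp
  then have "rGamma (-1/6) * rGamma (1/6) = - (rGamma (1/6) * rGamma (1 - 1/6)) / (6 :: real)"
    by simp
  then have 2: "rGamma (-1/6) * rGamma (1/6) = - 1 / (12 * pi :: real)"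
    unfolding rGamma_reflection_real by (simp add: sin_30)
  have "(\<lambda>n. rGamma_series (-1/6) n * rGamma_series (1/6) n /
      (rGamma_series (1/2 - x) n * rGamma_series (1/2 + x) n)) \<longlonglongrightarrow>
      rGamma (-1/6) * rGamma (1/6) / (rGamma (1/2 - x) * rGamma (1/2 + x))"
    using c by (intro tendsto_intros) (auto simp: 1)
  also have "rGamma (-1/6) * rGamma (1/6) / (rGamma (1/2 - x) * rGamma (1/2 + x)) = - 1 / (12 * cos (pi * x))"
    unfolding 1 2 by simp
  finally show ?thesis
  proof (rule Lim_transform_eventually)
    show "\<forall>\<^sub>F n in sequentially. rGamma_series (-1/6) n * rGamma_series (1/6) n /
      (rGamma_series (1/2 - x) n * rGamma_series (1/2 + x) n) =
      real n * (pochhammer (-1/6) (Suc n) * pochhammer (1/6) (Suc n) /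
      (pochhammer (1/2 - x) (Suc n) * pochhammer (1/2 + x) (Suc n)))"
      using eventually_gt_at_top[of 0]
    proof eventually_elim
      case (elim n)
      \<comment> \<open>The lower exponents add up to 1 and the upper ones to 0, which leaves
        exactly the factor \<open>real n\<close> of the claim.\<close>
      have e: "exp ((1/2 - x) * ln (real n)) * exp ((1/2 + x) * ln (real n)) = real n"
        using elim by (simp flip: exp_add add: algebra_simps)
      have e': "exp ((-1/6) * ln (real n)) * exp ((1/6) * ln (real n)) = 1"
        by (simp flip: exp_add)
      have "rGamma_series (-1/6) n * rGamma_series (1/6) n /
        (rGamma_series (1/2 - x) n * rGamma_series (1/2 + x) n) =
        (exp ((1/2 - x) * ln (real n)) * exp ((1/2 + x) * ln (real n))) /
        (exp ((-1/6) * ln (real n)) * exp ((1/6) * ln (real n))) *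
        (pochhammer (-1/6) (Suc n) * pochhammer (1/6) (Suc n) /
        (pochhammer (1/2 - x) (Suc n) * pochhammer (1/2 + x) (Suc n)))"
        unfolding rGamma_series_def by simp
      then show ?case unfolding e e' by simp
    qed
  qed
qed

section \<open>The limit of large \<open>A\<close> and the evaluation at
  \<open>A = -1/2\<close>\<close>

text \<open>Here 5/2 + 3n = -1/2 + 3(n+1) is the parameter reached after n + 1 shifts from
  -1/2.\<close>

lemma hyp_term_LIMSEQ:
  "(\<lambda>n. hyp_term (5/2 + 3 * real n) x k) \<longlonglongrightarrow>
     pochhammer (1 + 3*x) k * pochhammer (1 - 3*x) k / pochhammer 2 (2*k)"
proof (induction k)
  case (Suc k)
  have r: "(\<lambda>n. (5/2 + 3 * real n - 1 + 2 * real k) * (5/2 + 3 * real n + 2 * real k) /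
      ((5/2 + 3 * real n + 2 + 3 * real k)\<^sup>2 - (3*x)\<^sup>2)) \<longlonglongrightarrow> 1"
    by real_asymp
  have eq: "pochhammer (1 + 3*x) (Suc k) * pochhammer (1 - 3*x) (Suc k) / pochhammer 2 (2 * Suc k) =
      pochhammer (1 + 3*x) k * pochhammer (1 - 3*x) k / pochhammer 2 (2*k) *
      ((real k + 1)\<^sup>2 - (3*x)\<^sup>2) / ((2 * real k + 2) * (2 * real k + 3)) * 1"
  proof -
    have "(real k + 1)\<^sup>2 - (3*x)\<^sup>2 = (1 + 3*x + real k) * (1 - 3*x + real k)"
      by (simp add: power2_eq_square algebra_simps)
    then show ?thesis
      unfolding pochhammer_double_Suc pochhammer_Suc[of _ k] by (simp add: mult_ac add_ac)
  qed
  have "(2 * real k + 2) * (2 * real k + 3) \<noteq> 0"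
    by (simp add: add_nonneg_eq_0_iff)
  then show ?case
    unfolding hyp_term_Suc eq by (intro tendsto_mult tendsto_divide tendsto_const Suc.IH r)
qed simp

text \<open>Division by n + 1 balances the growth of the linear factor, whose quotient tends to 3
  for each fixed \<open>k\<close>. The geometric bound is uniform in \<open>n\<close> and dominates
  the terms.\<close>

lemma hyp_sum_LIMSEQ:
  assumes x: "\<bar>x\<bar> \<le> 1/4" "x \<noteq> 0"
  shows "(\<lambda>n. hyp_sum (5/2 + 3 * real n) x / (real n + 1)) \<longlonglongrightarrow> 2 * sin (pi * x) / (sqrt 3 * x)"
proof -
  define L where "L k = pochhammer (1 + 3*x) k * pochhammer (1 - 3*x) k / pochhammer 2 (2*k)" for k
  \<comment> \<open>The angle pi/6 is chosen so that the powers of the sine absorb 4^k.\<close>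
  have sin_power: "sin (pi/6) ^ (2*k+1) = 1 / (2 * 4^k)" for k
    by (simp add: sin_30 power_mult power_divide)
  have "(\<lambda>k. pochhammer (1 + 3*x) k * pochhammer (1 - 3*x) k * 4^k / pochhammer 2 (2*k) *
      sin (pi/6) ^ (2*k+1)) sums (sin (2*(3*x)*(pi/6)) / (2*(3*x) * cos (pi/6)))"
    using x by (intro sin_multiple_hypergeometric) auto
  then have "(\<lambda>k. L k / 2) sums (sin (pi * x) / (3 * sqrt 3 * x))"
    unfolding sin_power by (simp add: L_def cos_30 mult_ac)
  from sums_mult[OF this, of 6] have L: "(\<lambda>k. 3 * L k) sums (2 * sin (pi * x) / (sqrt 3 * x))"
    by (simp add: mult_ac)
  define a where "a k n = (5/2 + 3 * real n + 4 * real k) / (real n + 1) * hyp_term (5/2 + 3 * real n) x k" for k n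
  have lim: "(\<lambda>n. a k n) \<longlonglongrightarrow> 3 * L k" for k
  proof -
    have "(\<lambda>n. (5/2 + 3 * real n + 4 * real k) / (real n + 1)) \<longlonglongrightarrow> 3"
      by real_asymp
    then show ?thesis unfolding a_def L_def by (rule tendsto_mult[OF _ hyp_term_LIMSEQ])
  qed
  have bd: "norm (a k n) \<le> (3 + 4 * real k) * (1/4)^k" for k n
  proof -
    have "\<bar>(5/2 + 3 * real n + 4 * real k) / (real n + 1)\<bar> \<le> 3 + 4 * real k"
      by (simp add: divide_simps) (simp add: algebra_simps)
    then show ?thesis
      unfolding a_def real_norm_def abs_mult using abs_hyp_term_le[of "5/2 + 3 * real n" x k] x
      by (intro mult_mono) auto
  qed
  have "(\<lambda>n. \<Sum>k. a k n) \<longlonglongrightarrow> (\<Sum>k. 3 * L k)"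
  proof (intro tannerys_theorem[THEN conjunct2, THEN conjunct2] lim)
    show "\<forall>\<^sub>F (k, n) in sequentially \<times>\<^sub>F sequentially. norm (a k n) \<le> (3 + 4 * real k) * (1/4)^k"
      using bd by (intro always_eventually) auto
    show "summable (\<lambda>k. (3 + 4 * real k) * (1/4::real)^k)"
      by (rule summable_linear_geometric)
  qed auto
  moreover have "(\<Sum>k. a k n) = hyp_sum (5/2 + 3 * real n) x / (real n + 1)" for n
    unfolding hyp_sum_def a_def using suminf_divide[OF summable_hyp_term[of "5/2 + 3 * real n" x], of "real n + 1"] x
    by simp
  ultimately show ?thesis
    using L by (simp add: sums_iff)
qed

text \<open>This iterates \<open>hyp_sum_shift\<close> from -1/2; the factors are linear in the step
  number and assemble into Pochhammer symbols.\<close>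

lemma hyp_sum_pochhammer:
  assumes x: "\<bar>x\<bar> \<le> 1/4"
  shows "hyp_sum (-1/2) x = pochhammer (-1/6) n * pochhammer (1/6) n /
    (pochhammer (1/2 - x) n * pochhammer (1/2 + x) n) * hyp_sum (-1/2 + 3 * real n) x"
proof (induction n)
  case (Suc n)
  define A where "A = -1/2 + 3 * real n"
  have "A \<noteq> 0" "A \<noteq> 1"
  proof -
    \<comment> \<open>\<open>A = 0\<close> would mean 6n = 1, and \<open>A = 1\<close> would mean 6n
      = 3.\<close>
    have "real (6 * n) \<noteq> real 1" "real (6 * n) \<noteq> real 3"
      unfolding of_nat_eq_iff by presburger+
    then show "A \<noteq> 0" "A \<noteq> 1" by (auto simp: A_def)
  qed
  then have "hyp_sum A x = A * (A+1) / ((A + 2)\<^sup>2 - (3*x)\<^sup>2) * hyp_sum (A+3) x"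
    using x by (intro hyp_sum_shift) (auto simp: A_def)
  also have "A * (A+1) = ((-1/6 + real n) * (1/6 + real n)) * 9"
    by (simp add: A_def algebra_simps)
  also have "(A + 2)\<^sup>2 - (3*x)\<^sup>2 = ((1/2 - x + real n) * (1/2 + x + real n)) * 9"
    by (simp add: A_def power2_eq_square algebra_simps)
  also have "A + 3 = -1/2 + 3 * real (Suc n)"
    by (simp add: A_def)
  finally show ?case
    using Suc.IH unfolding A_def pochhammer_Suc by (simp add: mult_ac)
qed simp

text \<open>The product of \<open>Q n\<close> and the shifted sum is independent of
  \<open>n\<close>, so its value is its limit. The shift factors contribute the cosine and the
  limiting series the sine.\<close>

lemma hyp_sum_eq_tan:
  assumes x: "\<bar>x\<bar> \<le> 1/4" "x \<noteq> 0"
  shows "hyp_sum (-1/2) x = - tan (pi * x) / (6 * sqrt 3 * x)"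
proof -
  define Q where "Q n = pochhammer (-1/6) (Suc n) * pochhammer (1/6) (Suc n) /
      (pochhammer (1/2 - x) (Suc n) * pochhammer (1/2 + x) (Suc n))" for n
  have 1: "(\<lambda>n. real n * Q n) \<longlonglongrightarrow> - 1 / (12 * cos (pi * x))"
    unfolding Q_def using x by (intro pochhammer_ratio_LIMSEQ) auto
  have 2: "(\<lambda>n. (real n + 1) / real n) \<longlonglongrightarrow> 1" by real_asymp
  have "(\<lambda>n. real n * Q n * ((real n + 1) / real n) * (hyp_sum (5/2 + 3 * real n) x / (real n + 1)))
     \<longlonglongrightarrow> - 1 / (12 * cos (pi * x)) * 1 * (2 * sin (pi * x) / (sqrt 3 * x))"
    by (intro tendsto_mult 1 2 hyp_sum_LIMSEQ x)
  moreover have "\<forall>\<^sub>F n in sequentially. real n * Q n * ((real n + 1) / real n) *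
      (hyp_sum (5/2 + 3 * real n) x / (real n + 1)) = hyp_sum (-1/2) x"
    using eventually_gt_at_top[of 0]
  proof eventually_elim
    case (elim n)
    have "-1/2 + 3 * real (Suc n) = 5/2 + 3 * real n" by simp
    then have "hyp_sum (-1/2) x = Q n * hyp_sum (5/2 + 3 * real n) x"
      using hyp_sum_pochhammer[OF x(1), of "Suc n"] unfolding Q_def by simp
    moreover have "real n + 1 \<noteq> 0" by linarith
    ultimately show ?case using elim by simp
  qed
  ultimately have "(\<lambda>n::nat. hyp_sum (-1/2) x) \<longlonglongrightarrow> - 1 / (12 * cos (pi * x)) * 1 * (2 * sin (pi * x) / (sqrt 3 * x))"
    by (rule Lim_transform_eventually)
  then show ?thesis
    unfolding LIMSEQ_const_iff by (simp add: tan_def)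
qed

section \<open>Second-order expansion of the deformation in \<open>x\<close>\<close>

text \<open>This is the i-th factor of (1+3x)_k (1-3x)_k / ((1/2+x)_k (1/2-x)_k), divided by its
  value at \<open>x = 0\<close>.\<close>

definition param_factor :: "real \<Rightarrow> nat \<Rightarrow> real" where
  "param_factor x i = (1 - 9 * x\<^sup>2 / (real i)\<^sup>2) / (1 - 4 * x\<^sup>2 / (2 * real i - 1)\<^sup>2)"

text \<open>The bounds are uniform in \<open>i\<close> so that they can dominate; the constant 12 is
  9 / (3/4), from |p - q| \<le> 9 and 1 - x^2 p \<ge> 3/4. The last clause displays the factor x^2
  that the difference quotient cancels.\<close>

lemma param_factor_bounds:
  assumes x: "\<bar>x\<bar> \<le> 1/4" and i: "i \<ge> 1"
  shows "0 \<le> param_factor x i" "param_factor x i \<le> 1" "\<bar>param_factor x i - 1\<bar> \<le> 12 * x\<^sup>2"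
    "param_factor x i - 1 = x\<^sup>2 * ((4 / (2 * real i - 1)\<^sup>2 - 9 / (real i)\<^sup>2) / (1 - 4 * x\<^sup>2 / (2 * real i - 1)\<^sup>2))"
proof -
  have i': "real i \<ge> 1" using i by simp
  have x2: "x\<^sup>2 \<le> 1/16"
    using x abs_le_square_iff[of x "1/4"] by (simp add: power2_eq_square)
  define p where "p = 4 / (2 * real i - 1)\<^sup>2"
  define q where "q = 9 / (real i)\<^sup>2"
  have p: "0 \<le> p" "p \<le> 4"
    using one_le_power[of "2 * real i - 1" 2] i' by (auto simp: p_def divide_simps)
  have q: "0 \<le> q" "q \<le> 9"
    using one_le_power[of "real i" 2] i' by (auto simp: q_def divide_simps)
  have pq: "p \<le> q"
  proof -
    have "(2 * real i)\<^sup>2 \<le> (3 * (2 * real i - 1))\<^sup>2" using i' by (intro power_mono) auto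
    then have "4 * (real i)\<^sup>2 \<le> 9 * (2 * real i - 1)\<^sup>2" by (simp only: power_mult_distrib) simp
    moreover have "2 * real i - 1 \<noteq> 0" "real i \<noteq> 0" using i' by auto
    ultimately show ?thesis
      unfolding p_def q_def by (simp add: divide_simps)
  qed
  have f_eq: "param_factor x i = (1 - x\<^sup>2 * q) / (1 - x\<^sup>2 * p)"
    by (simp add: param_factor_def p_def q_def mult_ac)
  have xp: "x\<^sup>2 * p \<le> 1/4" using mult_mono[OF x2 p(2)] p by simp
  have xq: "x\<^sup>2 * q \<le> 9/16" using mult_mono[OF x2 q(2)] q by simp
  have xpq: "x\<^sup>2 * p \<le> x\<^sup>2 * q" using pq by (intro mult_left_mono) auto
  show "0 \<le> param_factor x i" using xp xq by (simp add: f_eq)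
  show "param_factor x i \<le> 1" using xp xpq by (simp add: f_eq)
  have eq: "param_factor x i - 1 = x\<^sup>2 * ((p - q) / (1 - x\<^sup>2 * p))"
    using xp by (simp add: f_eq divide_simps) (simp add: algebra_simps)
  then show "param_factor x i - 1 = x\<^sup>2 * ((4 / (2 * real i - 1)\<^sup>2 - 9 / (real i)\<^sup>2) / (1 - 4 * x\<^sup>2 / (2 * real i - 1)\<^sup>2))"
    by (simp add: p_def q_def mult_ac)
  have "\<bar>(p - q) / (1 - x\<^sup>2 * p)\<bar> \<le> 9 / (3/4)"
    unfolding abs_divide using p q pq xp by (intro frac_le) auto
  from mult_left_mono[OF this, of "x\<^sup>2"] show "\<bar>param_factor x i - 1\<bar> \<le> 12 * x\<^sup>2"
    by (simp add: eq abs_mult)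
qed

text \<open>For factors in [0,1] the deviations from 1 at most add up, by P f - 1 = P (f - 1) + (P -
  1). The bound linear in \<open>k\<close> is harmless against (1/4)^k.\<close>

lemma prod_param_factor_bounds:
  assumes x: "\<bar>x\<bar> \<le> 1/4"
  shows "0 \<le> prod (param_factor x) {1..k} \<and> prod (param_factor x) {1..k} \<le> 1 \<and>
    \<bar>prod (param_factor x) {1..k} - 1\<bar> \<le> 12 * real k * x\<^sup>2"
proof (induction k)
  case (Suc k)
  define P where "P = prod (param_factor x) {1..k}"
  note f = param_factor_bounds[OF x, of "Suc k", simplified]
  have P: "0 \<le> P" "P \<le> 1" "\<bar>P - 1\<bar> \<le> 12 * real k * x\<^sup>2" using Suc.IH by (auto simp: P_def)
  have "\<bar>P * param_factor x (Suc k) - 1\<bar> = \<bar>P * (param_factor x (Suc k) - 1) + (P - 1)\<bar>" by (simp add: algebra_simps)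
  also have "\<dots> \<le> P * \<bar>param_factor x (Suc k) - 1\<bar> + \<bar>P - 1\<bar>"
    using P by (metis abs_mult abs_of_nonneg abs_triangle_ineq)
  also have "\<dots> \<le> 1 * (12 * x\<^sup>2) + 12 * real k * x\<^sup>2"
    using P f(3) by (intro add_mono mult_mono) auto
  finally have "\<bar>P * param_factor x (Suc k) - 1\<bar> \<le> 12 * real (Suc k) * x\<^sup>2" by (simp add: algebra_simps)
  moreover have "0 \<le> P * param_factor x (Suc k)" "P * param_factor x (Suc k) \<le> 1"
    using P f(1,2) by (auto intro: mult_le_one)
  ultimately show ?case by (simp add: P_def)
qed simp

lemma param_factor_tendsto: "i \<ge> 1 \<Longrightarrow> ((\<lambda>x. param_factor x i) \<longlongrightarrow> 1) (at 0)"
proof -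
  assume "i \<ge> 1"
  then have "real i \<ge> 1" by simp
  then have "((\<lambda>x. param_factor x i) \<longlongrightarrow> (1 - 9 * 0\<^sup>2 / (real i)\<^sup>2) / (1 - 4 * 0\<^sup>2 / (2 * real i - 1)\<^sup>2)) (at 0)"
    unfolding param_factor_def by (intro tendsto_intros) auto
  then show ?thesis by simp
qed

lemma prod_param_factor_tendsto: "((\<lambda>x. prod (param_factor x) {1..k}) \<longlongrightarrow> 1) (at 0)"
proof -
  have "((\<lambda>x. prod (param_factor x) {1..k}) \<longlongrightarrow> (\<Prod>i=1..k. 1)) (at 0)"
    by (intro tendsto_prod param_factor_tendsto) auto
  then show ?thesis by simp
qed

lemma eventually_at_0_quarter: "\<forall>\<^sub>F x in at (0::real). \<bar>x\<bar> \<le> 1/4 \<and> x \<noteq> 0"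
  unfolding eventually_at by (intro exI[of _ "1/4"]) (auto simp: dist_real_def)

lemma eventually_prod_at_0_quarter:
  "\<forall>\<^sub>F z in (F \<times>\<^sub>F at (0::real)). \<bar>snd z\<bar> \<le> 1/4 \<and> snd z \<noteq> 0"
  using eventually_prodI[OF eventually_True eventually_at_0_quarter] by simp

text \<open>This is where the inner sum of the theorem arises: for a product of factors equal to 1
  at \<open>x = 0\<close>, the coefficients of x^2 add.\<close>

lemma prod_param_factor_diff_tendsto:
  "((\<lambda>x. (prod (param_factor x) {1..k} - 1) / x\<^sup>2) \<longlongrightarrow>
     4 * (\<Sum>i=1..k. 1 / (2 * real i - 1)\<^sup>2 - 9 / (4 * (real i)\<^sup>2))) (at 0)"
proof (induction k)
  case (Suc k)
  define i where "i = Suc k"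
  have i: "real i \<ge> 1" by (simp add: i_def)
  have "((\<lambda>x. (4 / (2 * real i - 1)\<^sup>2 - 9 / (real i)\<^sup>2) / (1 - 4 * x\<^sup>2 / (2 * real i - 1)\<^sup>2)) \<longlongrightarrow>
     (4 / (2 * real i - 1)\<^sup>2 - 9 / (real i)\<^sup>2) / (1 - 4 * 0\<^sup>2 / (2 * real i - 1)\<^sup>2)) (at 0)"
    using i by (intro tendsto_intros) auto
  then have "((\<lambda>x. (param_factor x i - 1) / x\<^sup>2) \<longlongrightarrow>
      (4 / (2 * real i - 1)\<^sup>2 - 9 / (real i)\<^sup>2) / (1 - 4 * 0\<^sup>2 / (2 * real i - 1)\<^sup>2)) (at 0)"
  proof (rule Lim_transform_eventually)
    show "\<forall>\<^sub>F x in at 0. (4 / (2 * real i - 1)\<^sup>2 - 9 / (real i)\<^sup>2) / (1 - 4 * x\<^sup>2 / (2 * real i - 1)\<^sup>2) =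
        (param_factor x i - 1) / x\<^sup>2"
      using eventually_at_0_quarter
    proof eventually_elim
      case (elim x)
      then show ?case using param_factor_bounds(4)[of x i] by (simp add: i_def)
    qed
  qed
  then have "((\<lambda>x. prod (param_factor x) {1..k} * ((param_factor x i - 1) / x\<^sup>2) +
      (prod (param_factor x) {1..k} - 1) / x\<^sup>2) \<longlongrightarrow>
      1 * ((4 / (2 * real i - 1)\<^sup>2 - 9 / (real i)\<^sup>2) / (1 - 4 * 0\<^sup>2 / (2 * real i - 1)\<^sup>2)) +
      4 * (\<Sum>i=1..k. 1 / (2 * real i - 1)\<^sup>2 - 9 / (4 * (real i)\<^sup>2))) (at 0)"
    by (intro tendsto_add tendsto_mult prod_param_factor_tendsto Suc.IH)
  also have "(\<lambda>x. prod (param_factor x) {1..k} * ((param_factor x i - 1) / x\<^sup>2) +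
      (prod (param_factor x) {1..k} - 1) / x\<^sup>2) =
      (\<lambda>x. (prod (param_factor x) {1..Suc k} - 1) / x\<^sup>2)"
    by (intro ext) (simp add: i_def add_divide_distrib[symmetric] algebra_simps)
  finally show ?case by (simp add: i_def algebra_simps)
qed simp

text \<open>At \<open>A = -1/2\<close> the denominator base is -1/2 + 2 + 3k = (3/2)(2k + 1), so the
  dependence of each term ratio on \<open>x\<close> is exactly one
  \<open>param_factor\<close>.\<close>

lemma hyp_term_eq_prod_param_factor:
  "hyp_term (-1/2) x k = hyp_term (-1/2) 0 k * prod (param_factor x) {1..k}"
proof (induction k)
  case (Suc k)
  define a where "a = real k + 1"
  define b where "b = (2 * a - 1)"
  have a: "a \<ge> 1" "b \<ge> 1" by (simp_all add: a_def b_def)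
  have eq: "(a\<^sup>2 - (3*x)\<^sup>2) / (((3/2) * b)\<^sup>2 - (3*x)\<^sup>2) = a\<^sup>2 / ((3/2) * b)\<^sup>2 * param_factor x (Suc k)"
  proof -
    have "param_factor x (Suc k) = (1 - 9 * x\<^sup>2 / a\<^sup>2) / (1 - 4 * x\<^sup>2 / b\<^sup>2)"
      by (simp add: param_factor_def a_def b_def algebra_simps)
    also have "1 - 9 * x\<^sup>2 / a\<^sup>2 = (a\<^sup>2 - (3*x)\<^sup>2) / a\<^sup>2"
      using a by (simp add: field_simps)
    also have "1 - 4 * x\<^sup>2 / b\<^sup>2 = (((3/2) * b)\<^sup>2 - (3*x)\<^sup>2) / ((3/2) * b)\<^sup>2"
      using a by (simp add: field_simps power2_eq_square)
    finally show ?thesis using a by simp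
  qed
  have b: "-1/2 + 2 + 3 * real k = (3/2) * b" by (simp add: a_def b_def)
  define C where "C = (-1/2 - 1 + 2 * real k) * (-1/2 + 2 * real k) / ((2 * real k + 2) * (2 * real k + 3))"
  have step: "hyp_term (-1/2) t (Suc k) =
      hyp_term (-1/2) t k * C * ((a\<^sup>2 - (3*t)\<^sup>2) / (((3/2) * b)\<^sup>2 - (3*t)\<^sup>2))" for t
    unfolding hyp_term_Suc b a_def[symmetric] C_def by simp
  show ?case
    unfolding step Suc.IH eq by simp
qed simp

section \<open>Comparison of the coefficients of x^2 on both sides\<close>

theorem theorem1p3:
  shows "(\<lambda>m. let k = Suc m in
            (8 * real k - 1)
            * (pochhammer (1::real) k * pochhammer (-1/4) k * pochhammer (-3/4) k)
              / ((pochhammer (1/2) k)^2 * pochhammer (3/2) k * 9 ^ k)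
            * (\<Sum>i=1..k. 1 / (2 * real i - 1)^2 - 9 / (4 * (real i)^2)))
         sums (- sqrt 3 * pi ^ 3 / 108)"
proof -
  define T where "T k = (-1/2 + 4 * real k) * hyp_term (-1/2) 0 k" for k
  define H where "H k = (\<Sum>i=1..k. 1 / (2 * real i - 1)\<^sup>2 - 9 / (4 * (real i)\<^sup>2))" for k
  \<comment> \<open>The factor 2 turns -1/2 + 4k into (8k - 1)/1; the rest is the duplication
    formula.\<close>
  have T_eq: "2 * T k = (8 * real k - 1) * (pochhammer 1 k * pochhammer (-1/4) k * pochhammer (-3/4) k)
              / ((pochhammer (1/2) k)\<^sup>2 * pochhammer (3/2) k * 9 ^ k)" for k
  proof -
    have "pochhammer (-3/2 :: real) (2*k) = of_nat (2^(2*k)) * pochhammer (-3/4) k * pochhammer (-1/4) k"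
      using pochhammer_double[of "-3/4::real" k] by simp
    moreover have "pochhammer (2 :: real) (2*k) = of_nat (2^(2*k)) * pochhammer 1 k * pochhammer (3/2) k"
      using pochhammer_double[of "1::real" k] by simp
    moreover have "pochhammer (1::real) k \<noteq> 0" by (simp add: pochhammer_fact[symmetric])
    ultimately show ?thesis
      by (simp add: T_def hyp_term_def power2_eq_square divide_simps)
  qed
  have T_le: "\<bar>T k\<bar> \<le> (1 + 4 * real k) * (1/4)^k" for k
    unfolding T_def abs_mult using abs_hyp_term_le[of "-1/2" 0 k] by (intro mult_mono) auto
  have T: "summable T"
    using summable_hyp_term[of "-1/2" 0] by (simp add: T_def[abs_def])
  have TP: "(\<lambda>k. T k * prod (param_factor x) {1..k}) sums (- tan (pi * x) / (6 * sqrt 3 * x))"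
    if "\<bar>x\<bar> \<le> 1/4" "x \<noteq> 0" for x
  proof -
    have "(\<lambda>k. (-1/2 + 4 * real k) * hyp_term (-1/2) x k) sums hyp_sum (-1/2) x"
      unfolding hyp_sum_def using that by (intro summable_sums summable_hyp_term) auto
    then show ?thesis
      unfolding hyp_sum_eq_tan[OF that] hyp_term_eq_prod_param_factor[of x] T_def
      by (simp only: mult.assoc)
  qed
  \<comment> \<open>A first dominated limit settles order zero, the constant to be subtracted before
    dividing by x^2.\<close>
  have "((\<lambda>x. \<Sum>k. T k * prod (param_factor x) {1..k}) \<longlongrightarrow> suminf T) (at 0)"
  proof (intro tannerys_theorem[THEN conjunct2, THEN conjunct2])
    show "((\<lambda>x. T k * prod (param_factor x) {1..k}) \<longlongrightarrow> T k) (at 0)" for k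
      using tendsto_mult[OF tendsto_const prod_param_factor_tendsto, of "T k" k] by simp
    show "\<forall>\<^sub>F (k, x) in sequentially \<times>\<^sub>F at 0.
        norm (T k * prod (param_factor x) {1..k}) \<le> (1 + 4 * real k) * (1/4)^k"
      using eventually_prod_at_0_quarter
    proof eventually_elim
      case (elim z)
      obtain k x where z: "z = (k, x)" by (cases z)
      have "norm (T k * prod (param_factor x) {1..k}) \<le> (1 + 4 * real k) * (1/4)^k * 1"
        unfolding norm_mult using elim T_le[of k] prod_param_factor_bounds[of x k] by (intro mult_mono) (auto simp: z)
      then show ?case by (simp add: z)
    qed
    show "summable (\<lambda>k. (1 + 4 * real k) * (1/4::real)^k)"
      using summable_linear_geometric[of 1 4] by simp
  qed auto
  moreover have "((\<lambda>x. \<Sum>k. T k * prod (param_factor x) {1..k}) \<longlongrightarrow> - pi / (6 * sqrt 3)) (at 0)"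
  proof (rule Lim_transform_eventually)
    show "((\<lambda>x. - tan (pi * x) / (6 * sqrt 3 * x)) \<longlongrightarrow> - pi / (6 * sqrt 3)) (at 0)"
      by (real_asymp simp: field_simps sqrt_def)
    show "\<forall>\<^sub>F x in at 0. - tan (pi * x) / (6 * sqrt 3 * x) = (\<Sum>k. T k * prod (param_factor x) {1..k})"
      using eventually_at_0_quarter by eventually_elim (use TP in \<open>simp add: sums_iff\<close>)
  qed
  ultimately have sumT: "suminf T = - pi / (6 * sqrt 3)"
    by (rule tendsto_unique[OF at_neq_bot])
  \<comment> \<open>The second dominated limit runs over difference quotients, with majorant
    \<open>12 * real k\<close> times that of \<open>T k\<close>.\<close>
  define a where "a k x = T k * ((prod (param_factor x) {1..k} - 1) / x\<^sup>2)" for k x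
  have "summable (\<lambda>n. norm (T n * (4 * H n))) \<and>
     ((\<lambda>x. \<Sum>k. a k x) \<longlongrightarrow> (\<Sum>k. T k * (4 * H k))) (at 0)"
  proof (intro tannerys_theorem[THEN conjunct2])
    show "((\<lambda>x. a k x) \<longlongrightarrow> T k * (4 * H k)) (at 0)" for k
      unfolding a_def H_def by (intro tendsto_intros prod_param_factor_diff_tendsto)
    show "\<forall>\<^sub>F (k, x) in sequentially \<times>\<^sub>F at 0. norm (a k x) \<le> (1 + 4 * real k) * (1/4)^k * (12 * real k)"
      using eventually_prod_at_0_quarter
    proof eventually_elim
      case (elim z)
      obtain k x where z: "z = (k, x)" by (cases z)
      have "norm ((prod (param_factor x) {1..k} - 1) / x\<^sup>2) \<le> 12 * real k"
        using elim prod_param_factor_bounds[of x k] by (auto simp: z abs_divide pos_divide_le_eq)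
      then have "norm (a k x) \<le> (1 + 4 * real k) * (1/4)^k * (12 * real k)"
        unfolding a_def norm_mult using T_le[of k] by (intro mult_mono) auto
      then show ?case by (simp add: z)
    qed
    show "summable (\<lambda>k. (1 + 4 * real k) * (1/4::real)^k * (12 * real k))"
    proof (rule summable_ratio_test[of "3/4" 4])
      fix n :: nat assume "n \<ge> 4"
      then have "4 * real n \<le> real n * real n" "real n \<ge> 4" by (auto intro: mult_right_mono)
      moreover have "9 * (1 + 4 * real n) * real n - 3 * (5 + 4 * real n) * (real n + 1) =
          24 * (real n * real n) - 18 * real n - 15"
        by (simp add: algebra_simps)
      ultimately have "3 * (5 + 4 * real n) * (real n + 1) \<le> 9 * (1 + 4 * real n) * real n"
        by linarith
      from mult_right_mono[OF this, of "(1/4)^n"]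
      show "norm ((1 + 4 * real (Suc n)) * (1/4)^Suc n * (12 * real (Suc n))) \<le>
          3/4 * norm ((1 + 4 * real n) * (1/4::real)^n * (12 * real n))"
        by (simp add: abs_mult algebra_simps)
    qed simp
  qed auto
  then have TH: "summable (\<lambda>k. T k * (4 * H k))"
    and lim: "((\<lambda>x. \<Sum>k. a k x) \<longlongrightarrow> (\<Sum>k. T k * (4 * H k))) (at 0)"
    using summable_norm_cancel[of "\<lambda>k. T k * (4 * H k)"] by simp_all
  have "((\<lambda>x. \<Sum>k. a k x) \<longlongrightarrow> - (pi^3) / (18 * sqrt 3)) (at 0)"
  proof (rule Lim_transform_eventually)
    \<comment> \<open>The value comes from the cubic term of tan t = t + t^3/3 + ....\<close>
    show "((\<lambda>x. (- tan (pi * x) / (6 * sqrt 3 * x) - (- pi / (6 * sqrt 3))) / x\<^sup>2) \<longlongrightarrow> - (pi^3) / (18 * sqrt 3)) (at 0)"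
      by (real_asymp simp: field_simps sqrt_def power3_eq_cube)
    show "\<forall>\<^sub>F x in at 0. (- tan (pi * x) / (6 * sqrt 3 * x) - (- pi / (6 * sqrt 3))) / x\<^sup>2 = (\<Sum>k. a k x)"
      using eventually_at_0_quarter
    proof eventually_elim
      case (elim x)
      have "(\<lambda>k. (T k * prod (param_factor x) {1..k} - T k) / x\<^sup>2) sums
          ((- tan (pi * x) / (6 * sqrt 3 * x) - (- pi / (6 * sqrt 3))) / x\<^sup>2)"
        using elim summable_sums[OF T] unfolding sumT by (intro sums_divide sums_diff TP) auto
      moreover have "(T k * prod (param_factor x) {1..k} - T k) / x\<^sup>2 = a k x" for k
        by (simp add: a_def algebra_simps)
      ultimately show ?case by (simp add: sums_iff)
    qed
  qed
  from tendsto_unique[OF at_neq_bot lim this]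
  have "(\<Sum>k. T k * (4 * H k)) = - (pi^3) / (18 * sqrt 3)" .
  with TH have "(\<lambda>k. T k * (4 * H k)) sums (- (pi^3) / (18 * sqrt 3))"
    by (simp add: sums_iff)
  from sums_mult[OF this, of "1/2"]
  have "(\<lambda>k. 2 * T k * H k) sums (- (pi^3) / (36 * sqrt 3))" by (simp add: mult_ac)
  also have "- (pi^3) / (36 * sqrt 3) = - sqrt 3 * pi^3 / 108"
    by (simp add: field_simps)
  \<comment> \<open>The series may start at k = 1 because \<open>H 0\<close> is an empty
    sum.\<close>
  finally have "(\<lambda>m. 2 * T (Suc m) * H (Suc m)) sums (- sqrt 3 * pi^3 / 108)"
    by (subst sums_Suc_iff) (simp add: H_def)
  then show ?thesis
    unfolding T_eq H_def Let_def .
qed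

end
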